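(* Every $2$-connected graph $G$ satisfies $\mathrm{spc}(G) \leq 5$.
   Context: Graphs are finite, simple and connected. A graph is $k$-connected if it cannot be disconnected by deleting $k-1$ vertices. In a graph with colored edges (the coloring is arbitrary; adjacent edges may share a color), a path is strongly proper if its sequence of edge colors does not contain identical terms within a distance of at most two, i.e. any two distinct edges of the path that are consecutive on the path, or separated by exactly one edge on the path, have different colors. An edge-colored graph is strongly proper connected if every two distinct vertices are joined by at least one strongly proper path. $\mathrm{spc}(G)$ denotes the least number of colors in an edge coloring of $G$ that makes $G$ strongly proper connected. *)

theory Defs
  imports "Graph_Theory.Graph_Theory"
begin

text \<open>
  Finite simple graphs are the symmetric loop-free digraphs of \<open>pair_graph\<close>, in which every
  undirected edge is represented by its two opposite arcs. Edges proper are two-element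
  vertex sets, so that an edge colouring cannot distinguish the two arcs of an edge.
  \<open>Digraph_Component.connected\<close> excludes the null graph; the qualifier separates it from
  topological connectedness.
\<close>

definition edge_of :: "'a \<times> 'a \<Rightarrow> 'a set" where
  "edge_of e = {fst e, snd e}"

definition edges :: "'a pair_pre_digraph \<Rightarrow> 'a set set" where
  "edges G = edge_of ` parcs G"

text \<open>
  Deleting all vertices does not count as disconnecting, and there is no lower bound on the
  number of vertices: the complete graphs on one and two vertices are \<open>k\<close>-connected for all \<open>k\<close>.
\<close>

definition k_connected :: "nat \<Rightarrow> 'a pair_pre_digraph \<Rightarrow> bool" where
  "k_connected k G \<longleftrightarrow>
     (\<forall>S. S \<subset> pverts G \<and> card S < k \<longrightarrow>
        Digraph_Component.connected (with_proj G \<restriction> (pverts G - S)))"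

definition strongly_proper_path ::
  "'a pair_pre_digraph \<Rightarrow> ('a set \<Rightarrow> 'c) \<Rightarrow> 'a \<Rightarrow> ('a \<times> 'a) awalk \<Rightarrow> 'a \<Rightarrow> bool" where
  "strongly_proper_path G c u p v \<longleftrightarrow>
     pre_digraph.apath (with_proj G) u p v \<and>
     (\<forall>i j. i < j \<and> j \<le> i + 2 \<and> j < length p \<longrightarrow> c (edge_of (p ! i)) \<noteq> c (edge_of (p ! j)))"

definition strongly_proper_connected :: "'a pair_pre_digraph \<Rightarrow> ('a set \<Rightarrow> 'c) \<Rightarrow> bool" where
  "strongly_proper_connected G c \<longleftrightarrow>
     (\<forall>u \<in> pverts G. \<forall>v \<in> pverts G. u \<noteq> v \<longrightarrow> (\<exists>p. strongly_proper_path G c u p v))"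

definition spc :: "'a pair_pre_digraph \<Rightarrow> nat" where
  "spc G = (LEAST k. \<exists>c :: 'a set \<Rightarrow> nat. card (c ` edges G) = k \<and> strongly_proper_connected G c)"

text \<open>
  The set minimised over in \<open>spc\<close> is nonempty for every connected graph, since an injective
  colouring is admissible.
\<close>

lemma apath_edges_distinct:
  assumes "pair_graph G" and "pre_digraph.apath (with_proj G) u p v"
    and "i < j" and "j < length p"
  shows "edge_of (p ! i) \<noteq> edge_of (p ! j)"
proof -
  interpret pair_graph G by fact
  let ?vs = "pawalk_verts u p"
  have ap: "awalk u p v" "distinct ?vs"
    using assms(2) by (auto simp: apath_def)
  have cas: "pcas u p v" using ap(1) by (auto simp: awalk_def)
  have len: "length ?vs = Suc (length p)" by (rule length_awalk_verts)
  have f: "?vs ! k = fst (p ! k)" if "k < length p" for k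
    using awalk_verts_conv[of u p] that by (auto simp: nth_append)
  have s: "?vs ! Suc k = snd (p ! k)" if "k < length p" for k
    using awalk_verts_conv'[OF cas] that by auto
  have "?vs ! i \<noteq> ?vs ! j" "?vs ! i \<noteq> ?vs ! Suc j"
    using assms(3,4) ap(2) len by (auto simp: nth_eq_iff_index_eq)
  then show ?thesis
    using f[of i] f[of j] s[of j] assms(3,4) by (auto simp: edge_of_def)
qed

lemma spc_attained:
  fixes G :: "'a pair_pre_digraph"
  assumes "pair_graph G" and "Digraph_Component.connected (with_proj G)"
  shows "\<exists>c :: 'a set \<Rightarrow> nat. card (c ` edges G) = spc G \<and> strongly_proper_connected G c"
proof -
  interpret pair_graph G by fact
  have "finite (edges G)" by (simp add: edges_def)
  then obtain c :: "'a set \<Rightarrow> nat" where c: "inj_on c (edges G)"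
    using finite_imp_inj_to_nat_seg by blast
  have "strongly_proper_connected G c"
    unfolding strongly_proper_connected_def
  proof (intro ballI impI)
    fix u v assume uv: "u \<in> pverts G" "v \<in> pverts G" "u \<noteq> v"
    have "strongly_connected (with_proj G)"
      using assms(2) symmetric_connected_imp_strongly_connected sym_arcs by blast
    then have "u \<rightarrow>\<^sup>*\<^bsub>with_proj G\<^esub> v"
      using uv by (auto simp: strongly_connected_def)
    then obtain p where p: "apath u p v"
      using reachable_apath by blast
    have arcs: "set p \<subseteq> parcs G" using p by (auto simp: apath_def awalk_def)
    have "c (edge_of (p ! i)) \<noteq> c (edge_of (p ! j))" if ij: "i < j" "j < length p" for i j
    proof -
      have "p ! i \<in> parcs G" "p ! j \<in> parcs G"
        using ij arcs by (meson less_trans nth_mem subsetD)+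
      then have "edge_of (p ! i) \<in> edges G" "edge_of (p ! j) \<in> edges G"
        by (auto simp: edges_def)
      then show ?thesis
        using c apath_edges_distinct[OF assms(1) p ij] by (auto dest: inj_onD)
    qed
    then show "\<exists>p. strongly_proper_path G c u p v"
      using p unfolding strongly_proper_path_def by blast
  qed
  then have "\<exists>k. \<exists>c :: 'a set \<Rightarrow> nat. card (c ` edges G) = k \<and> strongly_proper_connected G c"
    by blast
  then show ?thesis unfolding spc_def by (rule LeastI_ex)
qed

end

theory Submission
  imports Defs
begin

text \<open>
  A \<open>2\<close>-connected graph with an edge \<open>st\<close> has an \<open>st\<close>-order: the vertices can be listed from
  \<open>s\<close> to \<open>t\<close> so that each vertex other than \<open>s\<close> has an earlier neighbour and each vertex other
  than \<open>t\<close> a later one. Hence from every vertex a path descends to \<open>s\<close> through earlier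
  vertices and a path ascends to \<open>t\<close> through later ones. If \<open>u\<close> precedes \<open>w\<close>, then descending
  from \<open>u\<close> to \<open>s\<close>, crossing \<open>st\<close>, and following the ascending path of \<open>w\<close> backwards never
  repeats a vertex. It therefore suffices to colour the graph so that all chosen descending and
  ascending paths, each continued by the edge \<open>st\<close> of colour \<open>0\<close>, are strongly proper, and so
  that they fit together across \<open>st\<close>. The latter holds if descending paths enter \<open>s\<close> through
  an edge of colour \<open>1\<close>, while ascending paths never enter \<open>t\<close> through an edge of colour \<open>1\<close>.

  Order, paths and colouring are built together along an open ear decomposition. An ear from
  \<open>a\<close> to a later vertex \<open>b\<close> is inserted right after \<open>a\<close>; its inner vertices descend along the
  ear to \<open>a\<close> and ascend along the ear to \<open>b\<close>, and then use the path already chosen there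
  (\<open>good_order_add_ear\<close>). The first edge of the ear lies on descending paths only, so it only
  has to avoid the first two colours of the path of \<open>a\<close>, or to have colour \<open>1\<close> if \<open>a\<close> is \<open>s\<close>;
  the last edge is treated likewise at \<open>b\<close>. After
  these two are fixed, the remaining edges are coloured one by one. Such an edge can conflict with
  at most the two edges before it and the first two edges of what has been fixed ahead of it, so
  one of five colours is always free (\<open>two_sided_extension\<close>). Because every
  edge of an ear has an inner vertex of the ear as an end, older paths keep their colours. That an
  ear exists as long as a vertex is missing is where \<open>2\<close>-connectedness enters (\<open>ear_exists\<close>).
\<close>

section \<open>Colour words without repetition at distance at most two\<close>

fun locally_rainbow :: "'c list \<Rightarrow> bool" where
  "locally_rainbow [] \<longleftrightarrow> True"
| "locally_rainbow (x # xs) \<longleftrightarrow> x \<notin> set (take 2 xs) \<and> locally_rainbow xs"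

text \<open>
  The recursive form suits paths that grow at their front; the index form is the one of
  \<open>strongly_proper_path\<close> and makes the symmetry under reversal visible.
\<close>

lemma locally_rainbow_iff_nth:
  "locally_rainbow xs \<longleftrightarrow>
     (\<forall>i j. i < j \<and> j \<le> i + 2 \<and> j < length xs \<longrightarrow> xs ! i \<noteq> xs ! j)"
proof (induction xs)
  case (Cons x xs)
  have hd_clause: "x \<notin> set (take 2 xs) \<longleftrightarrow> (\<forall>j<length xs. j < 2 \<longrightarrow> x \<noteq> xs ! j)"
    by (auto simp: in_set_conv_nth)
  show ?case (is "_ \<longleftrightarrow> ?R")
  proof
    assume l: "locally_rainbow (x # xs)"
    show ?R
    proof (intro allI impI)
      fix i j assume ij: "i < j \<and> j \<le> i + 2 \<and> j < length (x # xs)"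
      then obtain j' where j: "j = Suc j'" by (cases j) auto
      show "(x # xs) ! i \<noteq> (x # xs) ! j"
        using l ij j hd_clause Cons.IH by (cases i) auto
    qed
  next
    assume r: ?R
    have "x \<notin> set (take 2 xs)"
      unfolding hd_clause
    proof (intro allI impI)
      fix j assume "j < length xs" "j < 2"
      then show "x \<noteq> xs ! j" using r[rule_format, of 0 "Suc j"] by simp
    qed
    moreover have "locally_rainbow xs"
      unfolding Cons.IH
    proof (intro allI impI)
      fix i j assume "i < j \<and> j \<le> i + 2 \<and> j < length xs"
      then show "xs ! i \<noteq> xs ! j" using r[rule_format, of "Suc i" "Suc j"] by simp
    qed
    ultimately show "locally_rainbow (x # xs)" by simp
  qed
qed simp

lemma locally_rainbow_rev [simp]: "locally_rainbow (rev xs) \<longleftrightarrow> locally_rainbow xs"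
proof -
  have "locally_rainbow (rev ys)" if l: "locally_rainbow ys" for ys :: "'a list"
    unfolding locally_rainbow_iff_nth
  proof (intro allI impI)
    fix i j assume ij: "i < j \<and> j \<le> i + 2 \<and> j < length (rev ys)"
    define i' j' where "i' = length ys - Suc j" and "j' = length ys - Suc i"
    with ij have "i' < j' \<and> j' \<le> i' + 2 \<and> j' < length ys" by simp arith
    with l have "ys ! i' \<noteq> ys ! j'" unfolding locally_rainbow_iff_nth by blast
    with ij show "rev ys ! i \<noteq> rev ys ! j" by (simp add: rev_nth i'_def j'_def)
  qed
  from this[of xs] this[of "rev xs"] show ?thesis by auto
qed

lemma locally_rainbow_appendD2: "locally_rainbow (xs @ ys) \<Longrightarrow> locally_rainbow ys"
  by (induction xs) auto

text \<open>
  A violation in the joined word that lies in neither of the two overlapping parts would have to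
  jump over the shared letter \<open>z\<close>, and so could only concern its two neighbours. This is how a
  descending and an ascending path are joined across the edge \<open>st\<close>.
\<close>

lemma locally_rainbow_join:
  assumes "locally_rainbow (xs @ [z])" "locally_rainbow (z # ys)"
    and "xs \<noteq> [] \<Longrightarrow> ys \<noteq> [] \<Longrightarrow> last xs \<noteq> hd ys"
  shows "locally_rainbow (xs @ z # ys)"
  using assms
proof (induction xs)
  case (Cons x xs)
  have "x \<notin> set (take 2 (xs @ z # ys))"
  proof (cases xs)
    case Nil
    then show ?thesis using Cons.prems by (cases ys) (auto simp: numeral_2_eq_2)
  next
    case (Cons x' xs')
    then show ?thesis using Cons.prems by (cases xs') (auto simp: numeral_2_eq_2)
  qed
  then show ?case using Cons by (cases xs) auto
qed simp

lemma fresh_colour: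
  assumes "length F \<le> 4"
  obtains x :: nat where "x < 5" "x \<notin> set F"
proof -
  have "card (set F) < card {..<5::nat}"
    using card_length[of F] assms by simp
  then have "\<not> {..<5} \<subseteq> set F"
    using card_mono[of "set F" "{..<5::nat}"] by auto
  then show thesis using that by auto
qed

text \<open>
  The words \<open>p\<close> and \<open>q\<close> are the already coloured continuations at the two ends of an ear, and
  \<open>xs\<close> colours the edges in between. The letters of \<open>xs\<close> are chosen from the \<open>p\<close>-end on; each
  is kept different from the two letters nearest to it in the part of \<open>p\<close> grown so far and from
  the first two of \<open>q\<close>, which rules out at most four colours. Avoiding \<open>q\<close> long before it is
  reached is wasteful but makes the induction uniform.
  The words \<open>p\<close> and \<open>q\<close> never occur together in one condition, since no chosen path
  runs through the whole ear.
\<close>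

lemma two_sided_extension:
  fixes p q :: "nat list"
  assumes "locally_rainbow p" "locally_rainbow q"
  shows "\<exists>xs. length xs = n \<and> set xs \<subseteq> {..<5} \<and>
    locally_rainbow (rev xs @ p) \<and> locally_rainbow (xs @ q)"
  using assms
proof (induction n arbitrary: p)
  case 0
  then show ?case by simp
next
  case (Suc n)
  obtain x where x: "x < 5" "x \<notin> set (take 2 p @ take 2 q)"
    by (rule fresh_colour[of "take 2 p @ take 2 q"]) auto
  then have "locally_rainbow (x # p)" using Suc.prems by simp
  then obtain ys where ys: "length ys = n" "set ys \<subseteq> {..<5}"
    "locally_rainbow (rev ys @ x # p)" "locally_rainbow (ys @ q)"
    using Suc.IH Suc.prems(2) by blast
  have "locally_rainbow (rev p @ x # ys)"
    using ys(3) locally_rainbow_rev[of "rev ys @ x # p"] by simp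
  then have "locally_rainbow (x # ys)" by (rule locally_rainbow_appendD2)
  then have "x \<notin> set (take 2 (ys @ q))"
    using x by (cases q; cases ys; cases "tl ys") (auto simp: numeral_2_eq_2)
  then have "locally_rainbow ((x # ys) @ q)" using ys(4) by simp
  moreover have "locally_rainbow (rev (x # ys) @ p)" using ys(3) by simp
  moreover have "length (x # ys) = Suc n" "set (x # ys) \<subseteq> {..<5}" using ys x by auto
  ultimately show ?case by blast
qed

section \<open>Colour words of vertex lists\<close>

fun colour_word :: "('a set \<Rightarrow> 'c) \<Rightarrow> 'a list \<Rightarrow> 'c list" where
  "colour_word c (x # y # zs) = c {x, y} # colour_word c (y # zs)"
| "colour_word c _ = []"

lemma length_colour_word [simp]: "length (colour_word c xs) = length xs - 1"
  by (induction c xs rule: colour_word.induct) auto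

lemma colour_word_append:
  assumes "xs \<noteq> []" "ys \<noteq> []"
  shows "colour_word c (xs @ ys) =
    colour_word c xs @ c {last xs, hd ys} # colour_word c ys"
  using assms by (induction c xs rule: colour_word.induct) (auto simp: neq_Nil_conv)

lemma colour_word_rev: "colour_word c (rev xs) = rev (colour_word c xs)"
proof (induction xs)
  case (Cons x xs)
  show ?case
  proof (cases xs)
    case (Cons y ys)
    have "colour_word c (rev xs @ [x]) = rev (colour_word c xs) @ [c {y, x}]"
      using Cons \<open>colour_word c (rev xs) = rev (colour_word c xs)\<close> by (subst colour_word_append) auto
    then show ?thesis using Cons by (simp add: insert_commute)
  qed simp
qed simp

lemma colour_word_cong:
  assumes "\<And>e. e \<subseteq> set xs \<Longrightarrow> c e = c' e"
  shows "colour_word c xs = colour_word c' xs"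
  using assms by (induction c xs rule: colour_word.induct) auto

text \<open>
  A path with no edge inside \<open>S\<close> can be coloured at will without disturbing the colours
  inside \<open>S\<close>; distinctness of the vertices makes the edges distinct.
\<close>

lemma colouring_with_word:
  assumes "distinct xs" "length xs = Suc (length es)" "set es \<subseteq> C" "range c \<subseteq> C"
    and "successively (\<lambda>x y. \<not> {x, y} \<subseteq> S) xs"
  shows "\<exists>d. colour_word d xs = es \<and> (\<forall>e. e \<subseteq> S \<longrightarrow> d e = c e) \<and> range d \<subseteq> C"
  using assms
proof (induction xs arbitrary: es)
  case (Cons x xs)
  show ?case
  proof (cases xs)
    case Nil
    then show ?thesis using Cons.prems by auto
  next
    case xs: (Cons y ys)
    with Cons.prems obtain f fs where es: "es = f # fs" by (cases es) auto
    obtain d where d: "colour_word d xs = fs" "\<forall>e. e \<subseteq> S \<longrightarrow> d e = c e" "range d \<subseteq> C"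
      using Cons.IH[of fs] Cons.prems es xs by auto
    let ?d = "d({x, y} := f)"
    have "colour_word ?d xs = colour_word d xs"
      using Cons.prems(1) by (intro colour_word_cong) auto
    then have "colour_word ?d (x # xs) = es" using d es xs by simp
    moreover have "\<forall>e. e \<subseteq> S \<longrightarrow> ?d e = c e" using d Cons.prems xs by auto
    moreover have "range ?d \<subseteq> C" using d es Cons.prems by auto
    ultimately show ?thesis by blast
  qed
qed simp

lemma successively_rev_symp:
  assumes "symp E" "successively E xs"
  shows "successively E (rev xs)"
  unfolding successively_rev
  using assms(2) by (rule successively_mono) (use assms(1) in \<open>auto dest: sympD\<close>)

section \<open>Ordered lists of vertices with descending paths\<close>

text \<open>
  The list \<open>L\<close> is the vertex order and its head the root \<open>s\<close>. Ascending paths are descending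
  paths for the reversed list, so one predicate serves both. The trailing \<open>0\<close> stands for the
  edge \<open>st\<close> that follows at the root, and \<open>K\<close> is the set of colours with which a path may enter
  the root. The last vertex of \<open>L\<close> is exempt, since it never descends.
\<close>

definition descends ::
  "('a \<Rightarrow> 'a \<Rightarrow> bool) \<Rightarrow> ('a set \<Rightarrow> nat) \<Rightarrow> nat set \<Rightarrow> 'a list \<Rightarrow> bool" where
  "descends E c K L \<longleftrightarrow> (\<forall>A v B. L = A @ v # B \<and> B \<noteq> [] \<longrightarrow>
     (\<exists>Q. distinct (v # Q) \<and> set Q \<subseteq> set A \<and> last (v # Q) = hd L \<and> successively E (v # Q) \<and>
        locally_rainbow (colour_word c (v # Q) @ [0]) \<and>
        (Q \<noteq> [] \<longrightarrow> last (colour_word c (v # Q)) \<in> K)))"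

lemma descendsE:
  assumes "descends E c K L" "L = A @ v # B" "B \<noteq> []"
  obtains Q where "distinct (v # Q)" "set Q \<subseteq> set A" "last (v # Q) = hd L"
    "successively E (v # Q)" "locally_rainbow (colour_word c (v # Q) @ [0])"
    "Q \<noteq> [] \<Longrightarrow> last (colour_word c (v # Q)) \<in> K"
  using assms(1)[unfolded descends_def, rule_format, of A v B] assms(2,3) that by blast

text \<open>
  The inner vertices \<open>X\<close> of an ear leaving \<open>a\<close> may be inserted anywhere after \<open>a\<close>. The freedom
  of position matters because one insertion is used in both directions: vertices that directly
  follow one end of the ear in the order are in general far behind the other end in the reversed
  order. Old vertices keep their paths, and the path of a new vertex runs back along the ear to
  \<open>a\<close> and continues with \<open>Q\<close>. If \<open>Q\<close> is empty, then \<open>a\<close> is the root, and the first edge of the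
  ear is the one that enters it.
\<close>

lemma descends_insert:
  assumes desc: "descends E c K (M1 @ M2)" and "M2 \<noteq> []" and M1: "M1 = A @ a # B"
    and dist: "distinct (M1 @ X @ M2)"
    and Q: "distinct (a # Q)" "set Q \<subseteq> set A" "last (a # Q) = hd (M1 @ M2)"
      "successively E (a # Q)" "Q \<noteq> [] \<Longrightarrow> last (colour_word c (a # Q)) \<in> K"
    and agree: "\<And>e. e \<subseteq> set (M1 @ M2) \<Longrightarrow> c' e = c e"
    and "symp E" "successively E (a # X)"
    and rain: "locally_rainbow (rev (colour_word c' (a # X)) @ colour_word c (a # Q) @ [0])"
    and first: "Q = [] \<Longrightarrow> hd (colour_word c' (a # X)) \<in> K"
  shows "descends E c' K (M1 @ X @ M2)"
  unfolding descends_def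
proof (intro allI impI, elim conjE)
  fix A' v B' assume split: "M1 @ X @ M2 = A' @ v # B'" and "B' \<noteq> []"
  have hd_eq: "hd (M1 @ X @ M2) = hd (M1 @ M2)" using M1 by (cases A) auto
  have old: "\<exists>Q. distinct (v # Q) \<and> set Q \<subseteq> set A' \<and> last (v # Q) = hd (M1 @ X @ M2) \<and>
      successively E (v # Q) \<and> locally_rainbow (colour_word c' (v # Q) @ [0]) \<and>
      (Q \<noteq> [] \<longrightarrow> last (colour_word c' (v # Q)) \<in> K)"
    if dec: "M1 @ M2 = A0 @ v # B0" "B0 \<noteq> []" "set A0 \<subseteq> set A'" for A0 B0
  proof -
    obtain R where R: "distinct (v # R)" "set R \<subseteq> set A0" "last (v # R) = hd (M1 @ M2)"
      "successively E (v # R)" "locally_rainbow (colour_word c (v # R) @ [0])"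
      "R \<noteq> [] \<longrightarrow> last (colour_word c (v # R)) \<in> K"
      using desc dec unfolding descends_def by meson
    have "set (v # R) \<subseteq> set (M1 @ M2)" using R(2) dec(1) by auto
    then have "colour_word c' (v # R) = colour_word c (v # R)"
      by (intro colour_word_cong agree) auto
    then show ?thesis using R dec(3) hd_eq by (intro exI[of _ R]) auto
  qed
  have "v \<in> set M1 \<or> v \<in> set X \<or> v \<in> set M2"
    using arg_cong[OF split, of set] by auto
  then consider (lower) "v \<in> set M1" | (new) "v \<in> set X" | (upper) "v \<in> set M2" by blast
  then show "\<exists>Q. distinct (v # Q) \<and> set Q \<subseteq> set A' \<and> last (v # Q) = hd (M1 @ X @ M2) \<and>
      successively E (v # Q) \<and> locally_rainbow (colour_word c' (v # Q) @ [0]) \<and>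
      (Q \<noteq> [] \<longrightarrow> last (colour_word c' (v # Q)) \<in> K)"
  proof cases
    case lower
    then obtain M M' where M: "M1 = M @ v # M'" by (meson split_list)
    have "A' = M"
      using dist split M append_Cons_eq_iff[of v M "M' @ X @ M2" A' B'] by auto
    then show ?thesis by (intro old[of M "M' @ M2"]) (use M \<open>M2 \<noteq> []\<close> in auto)
  next
    case upper
    then obtain M M' where M: "M2 = M @ v # M'" by (meson split_list)
    have "A' = M1 @ X @ M \<and> B' = M'"
      using dist split M append_Cons_eq_iff[of v "M1 @ X @ M" M' A' B'] by auto
    then show ?thesis by (intro old[of "M1 @ M" M']) (use M \<open>B' \<noteq> []\<close> in auto)
  next
    case new
    then obtain X1 X2 where X: "X = X1 @ v # X2" by (meson split_list)
    have A': "A' = M1 @ X1"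
      using dist split X append_Cons_eq_iff[of v "M1 @ X1" "X2 @ M2" A' B'] by auto
    let ?R = "rev X1 @ a # Q"
    have wQ: "colour_word c' (a # Q) = colour_word c (a # Q)"
      using Q(2) M1 by (intro colour_word_cong agree) auto
    have w: "colour_word c' (v # ?R) =
        rev (colour_word c' (a # X1 @ [v])) @ colour_word c (a # Q)"
    proof (cases Q)
      case Nil
      then show ?thesis using colour_word_rev[of c' "a # X1 @ [v]"] by simp
    next
      case (Cons y Q')
      have "colour_word c' ((v # rev X1 @ [a]) @ Q) =
          colour_word c' (v # rev X1 @ [a]) @ colour_word c' (a # Q)"
        using Cons by (subst colour_word_append) auto
      then show ?thesis using colour_word_rev[of c' "a # X1 @ [v]"] wQ by simp
    qed
    have wX: "\<exists>W. colour_word c' (a # X) = colour_word c' (a # X1 @ [v]) @ W"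
      using X colour_word_append[of "a # X1 @ [v]" X2 c'] by (cases X2) auto
    have "locally_rainbow (colour_word c' (v # ?R) @ [0])"
      using rain wX w locally_rainbow_appendD2 by fastforce
    moreover have "last (colour_word c' (v # ?R)) \<in> K"
    proof (cases "Q = []")
      case True
      have ne: "colour_word c' (a # X1 @ [v]) \<noteq> []" by (cases X1) auto
      show ?thesis using True first wX ne unfolding w by (auto simp: last_rev)
    next
      case False
      then have "colour_word c (a # Q) \<noteq> []" by (cases Q) auto
      then show ?thesis using Q(5)[OF False] unfolding w by simp
    qed
    moreover have "successively E (v # ?R)"
    proof -
      have "successively E ((a # X1 @ [v]) @ X2)" using \<open>successively E (a # X)\<close> X by simp
      then have "successively E (a # X1 @ [v])" by (simp only: successively_append_iff)
      with \<open>symp E\<close> have "successively E (rev (a # X1 @ [v]))"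
        by (rule successively_rev_symp)
      then have "successively E ((v # rev X1 @ [a]) @ Q)"
        using Q(4) by (subst successively_append_iff) (auto simp: successively_Cons[of E a Q])
      then show ?thesis by simp
    qed
    moreover have "distinct (v # ?R)" using dist Q(1,2) M1 X by auto
    moreover have "set ?R \<subseteq> set A'" using A' M1 Q(2) by auto
    moreover have "last (v # ?R) = hd (M1 @ X @ M2)" using Q(3) hd_eq by simp
    ultimately show ?thesis by blast
  qed
qed

section \<open>Growing the order by ears\<close>

text \<open>
  Every colour in the first set \<open>{1}\<close> differs from every colour in its complement, so the two
  colours on either side of the edge \<open>st\<close> are always distinct.
\<close>

definition good_order :: "('a \<Rightarrow> 'a \<Rightarrow> bool) \<Rightarrow> ('a set \<Rightarrow> nat) \<Rightarrow> 'a list \<Rightarrow> bool" where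
  "good_order E c L \<longleftrightarrow> distinct L \<and> 2 \<le> length L \<and> range c \<subseteq> {..<5} \<and>
     E (hd L) (last L) \<and> c {hd L, last L} = 0 \<and>
     descends E c {1} L \<and> descends E c (- {1}) (rev L)"

lemma good_order_edge:
  assumes "E s t" "s \<noteq> t"
  shows "good_order E (\<lambda>_. 0) [s, t]"
  using assms unfolding good_order_def descends_def
  by (auto simp: Cons_eq_append_conv intro!: exI[of _ "[]"])

text \<open>
  The colours of the first and last edge of the ear are fixed before the others, because they
  must respect the restrictions at the roots. If \<open>a\<close> is the root \<open>s\<close>, the first edge gets colour
  \<open>1\<close>; if \<open>b\<close> is the root \<open>t\<close>, the last edge gets a colour other than \<open>0\<close> and \<open>1\<close>.
\<close>

lemma good_order_add_ear:
  assumes good: "good_order E c L" and sym: "symp E" and L: "L = A @ a # B @ b # D"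
    and X: "X \<noteq> []" "distinct X" "set X \<inter> set L = {}" "successively E (a # X @ [b])"
  shows "\<exists>c'. good_order E c' (A @ a # X @ B @ b # D)"
proof -
  let ?L' = "A @ a # X @ B @ b # D"
  note g = good[unfolded good_order_def]
  have revL: "rev L = rev D @ b # rev B @ a # rev A" using L by simp
  obtain Q where Q: "distinct (a # Q)" "set Q \<subseteq> set A" "last (a # Q) = hd L"
    "successively E (a # Q)" "locally_rainbow (colour_word c (a # Q) @ [0])"
    "Q \<noteq> [] \<Longrightarrow> last (colour_word c (a # Q)) \<in> {1}"
    by (rule descendsE[OF _ L]) (use g in auto)
  obtain R where R: "distinct (b # R)" "set R \<subseteq> set (rev D)" "last (b # R) = hd (rev L)"
    "successively E (b # R)" "locally_rainbow (colour_word c (b # R) @ [0])"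
    "R \<noteq> [] \<Longrightarrow> last (colour_word c (b # R)) \<in> - {1}"
    by (rule descendsE[OF _ revL]) (use g in auto)
  define p where "p = colour_word c (a # Q) @ [0]"
  define q where "q = colour_word c (b # R) @ [0]"
  obtain x where x: "x < 5" "locally_rainbow (x # p)" "Q = [] \<Longrightarrow> x = 1"
  proof (cases "Q = []")
    case True
    then show thesis by (intro that[of 1]) (auto simp: p_def)
  next
    case False
    obtain x where "x < 5" "x \<notin> set (take 2 p)" by (rule fresh_colour[of "take 2 p"]) auto
    then show thesis using that Q(5) False unfolding p_def by auto
  qed
  obtain y where y: "y < 5" "locally_rainbow (y # q)" "R = [] \<Longrightarrow> y \<noteq> 1"
  proof (cases "R = []")
    case True
    then show thesis by (intro that[of 2]) (auto simp: q_def)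
  next
    case False
    obtain y where "y < 5" "y \<notin> set (take 2 q)" by (rule fresh_colour[of "take 2 q"]) auto
    then show thesis using that R(5) False unfolding q_def by auto
  qed
  obtain xs where xs: "length xs = length X - 1" "set xs \<subseteq> {..<5}"
    "locally_rainbow (rev xs @ x # p)" "locally_rainbow (xs @ y # q)"
    using two_sided_extension[OF x(2) y(2)] by blast
  have dL: "distinct L" using g by blast
  have distX: "distinct (a # X @ [b])" using dL X L by auto
  have "successively (\<lambda>u v. \<not> {u, v} \<subseteq> set L) (a # X @ [b])"
  proof -
    have "successively (\<lambda>u v. \<not> {u, v} \<subseteq> set L) X" if "set X \<inter> set L = {}" for X
      using that by (induction X rule: induct_list012) auto
    then show ?thesis using X(1,3)
      by (auto simp: successively_append_iff successively_Cons disjoint_iff)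
  qed
  then obtain c' where c': "colour_word c' (a # X @ [b]) = x # xs @ [y]"
    "\<And>e. e \<subseteq> set L \<Longrightarrow> c' e = c e" "range c' \<subseteq> {..<5}"
    using colouring_with_word[OF distX, of "x # xs @ [y]" "{..<5}" c "set L"] X(1) xs x y g
    by (auto simp: Suc_pred)
  have w1: "colour_word c' (a # X) = x # xs"
    using c'(1) colour_word_append[of "a # X" "[b]" c'] by simp
  have "colour_word c' (X @ [b]) = xs @ [y]"
    using c'(1) X(1) by (cases X) auto
  then have w2: "rev (colour_word c' (b # rev X)) = xs @ [y]"
    using colour_word_rev[of c' "b # rev X"] by simp
  have distL': "distinct ?L'" using dL X L by auto
  have "descends E c' {1} ((A @ [a]) @ X @ (B @ b # D))"
  proof (rule descends_insert[where Q = Q and A = A and a = a and B = "[]" and c = c])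
    show "descends E c {1} ((A @ [a]) @ B @ b # D)" using g L by simp
    have "successively E ((a # X) @ [b])" using X(4) by simp
    then show "successively E (a # X)" by (simp only: successively_append_iff)
    show "locally_rainbow (rev (colour_word c' (a # X)) @ colour_word c (a # Q) @ [0])"
      using xs(3) by (simp add: w1 p_def)
    show "hd (colour_word c' (a # X)) \<in> {1}" if "Q = []" using x(3) that w1 by simp
    show "c' e = c e" if "e \<subseteq> set ((A @ [a]) @ B @ b # D)" for e
      using c'(2)[of e] that L by auto
  qed (use Q distL' L sym in auto)
  then have down: "descends E c' {1} ?L'" by simp
  have "descends E c' (- {1}) ((rev D @ b # rev B) @ rev X @ (a # rev A))"
  proof (rule descends_insert[where Q = R and A = "rev D" and a = b and B = "rev B" and c = c])
    show "descends E c (- {1}) ((rev D @ b # rev B) @ a # rev A)" using g revL by simp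
    have "successively E (X @ [b])" using X(4)
      by (auto simp: successively_Cons split: if_splits)
    with sym have "successively E (rev (X @ [b]))" by (rule successively_rev_symp)
    then show "successively E (b # rev X)" by simp
    show "locally_rainbow (rev (colour_word c' (b # rev X)) @ colour_word c (b # R) @ [0])"
      using xs(4) by (simp add: w2 q_def)
    show "hd (colour_word c' (b # rev X)) \<in> - {1}" if "R = []"
    proof -
      have "colour_word c' (b # rev X) = y # rev xs"
        using arg_cong[OF w2, of rev] by simp
      then show ?thesis using y(3) that by simp
    qed
    show "c' e = c e" if "e \<subseteq> set ((rev D @ b # rev B) @ a # rev A)" for e
      using c'(2)[of e] that L by auto
  qed (use R distL' revL sym in auto)
  then have up: "descends E c' (- {1}) (rev ?L')" by simp
  have ends: "hd ?L' = hd L" "last ?L' = last L" using L by (cases A; simp)+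
  have "L \<noteq> []" using L by simp
  then have "{hd L, last L} \<subseteq> set L" by auto
  then have "c' {hd ?L', last ?L'} = 0" using c'(2) g ends by simp
  then have "good_order E c' ?L'"
    unfolding good_order_def using down up distL' c'(3) ends g L by auto
  then show ?thesis by blast
qed

text \<open>
  Stopping at the first vertex of \<open>S\<close> and cutting out closed detours turns any connection into a
  path that meets \<open>S\<close> only at its end.
\<close>

lemma path_to_set:
  assumes "R\<^sup>*\<^sup>* x z" "z \<in> S" "x \<notin> S"
  shows "\<exists>X b. X \<noteq> [] \<and> hd X = x \<and> distinct X \<and> set X \<inter> S = {} \<and> successively R X \<and>
    b \<in> S \<and> R (last X) b"
  using assms
proof (induction rule: converse_rtranclp_induct)
  case base
  then show ?case by blast
next
  case (step x y)
  show ?case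
  proof (cases "y \<in> S")
    case True
    then show ?thesis using step by (intro exI[of _ "[x]"] exI[of _ y]) auto
  next
    case False
    then obtain X b where X: "X \<noteq> []" "hd X = y" "distinct X" "set X \<inter> S = {}"
      "successively R X" "b \<in> S" "R (last X) b"
      using step by blast
    show ?thesis
    proof (cases "x \<in> set X")
      case True
      then obtain Y Z where "X = Y @ x # Z" by (meson split_list)
      then show ?thesis using X
        by (intro exI[of _ "x # Z"] exI[of _ b]) (auto simp: successively_append_iff)
    next
      case False
      then show ?thesis using X step
        by (intro exI[of _ "x # X"] exI[of _ b]) (auto simp: successively_Cons)
    qed
  qed
qed

text \<open>
  By connectedness some edge \<open>ax\<close> leaves \<open>S\<close>. As \<open>a\<close> is not a cut vertex, \<open>x\<close> is still connected
  to \<open>S - {a}\<close> after deleting \<open>a\<close>, so that the ear returns to \<open>S\<close> at a vertex other than \<open>a\<close>.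
\<close>

lemma ear_exists:
  assumes conn: "\<And>u v. u \<in> V \<Longrightarrow> v \<in> V \<Longrightarrow> E\<^sup>*\<^sup>* u v"
    and conn1: "\<And>a u v. a \<in> V \<Longrightarrow> u \<in> V - {a} \<Longrightarrow> v \<in> V - {a} \<Longrightarrow>
      (\<lambda>x y. E x y \<and> y \<in> V - {a})\<^sup>*\<^sup>* u v"
    and E: "\<And>x y. E x y \<Longrightarrow> x \<in> V \<and> y \<in> V"
    and S: "S \<subset> V" "s \<in> S" "t \<in> S" "s \<noteq> t"
  obtains a X b where "a \<in> S" "b \<in> S" "a \<noteq> b" "X \<noteq> []" "distinct X"
    "set X \<inter> S = {}" "set X \<subseteq> V" "successively E (a # X @ [b])"
proof -
  obtain z where z: "z \<in> V" "z \<notin> S" using S by blast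
  obtain a x where ax: "a \<in> S" "x \<notin> S" "E a x"
  proof -
    have "E\<^sup>*\<^sup>* s z" using conn S z by blast
    then have "s \<in> S \<longrightarrow> (\<exists>a x. a \<in> S \<and> x \<notin> S \<and> E a x)"
      using z(2) by (induction rule: converse_rtranclp_induct) blast+
    then show thesis using that S by blast
  qed
  obtain w where w: "w \<in> S - {a}" using S by blast
  let ?R = "\<lambda>x y. E x y \<and> y \<in> V - {a}"
  have "x \<in> V - {a}" "w \<in> V - {a}" using ax E w S by blast+
  then have "?R\<^sup>*\<^sup>* x w" using conn1[of a] ax(1) S by blast
  then obtain X b where X: "X \<noteq> []" "hd X = x" "distinct X" "set X \<inter> S = {}"
    "successively ?R X" "b \<in> S" "?R (last X) b"
    using path_to_set[of ?R x w S] w ax(2) by blast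
  have "successively E X" using X(5) by (rule successively_mono) auto
  then have suc: "successively E (a # X @ [b])"
    using X ax by (auto simp: successively_append_iff successively_Cons)
  have "set X \<subseteq> V"
  proof -
    have "set X \<subseteq> V" if "successively ?R X" "X \<noteq> []" "hd X \<in> V" for X
      using that by (induction X rule: induct_list012) auto
    then show ?thesis using X \<open>x \<in> V - {a}\<close> by blast
  qed
  then show thesis using that[of a b X] ax X suc by auto
qed

lemma good_order_exists:
  assumes fin: "finite V" and sym: "symp E" and irr: "\<And>x. \<not> E x x"
    and conn: "\<And>u v. u \<in> V \<Longrightarrow> v \<in> V \<Longrightarrow> E\<^sup>*\<^sup>* u v"
    and conn1: "\<And>a u v. a \<in> V \<Longrightarrow> u \<in> V - {a} \<Longrightarrow> v \<in> V - {a} \<Longrightarrow>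
      (\<lambda>x y. E x y \<and> y \<in> V - {a})\<^sup>*\<^sup>* u v"
    and E: "\<And>x y. E x y \<Longrightarrow> x \<in> V \<and> y \<in> V"
    and uv: "u \<in> V" "v \<in> V" "u \<noteq> v"
  shows "\<exists>c L. good_order E c L \<and> set L = V"
proof -
  have grow: "\<exists>c' L'. good_order E c' L' \<and> set L' = V"
    if "good_order E c L" "set L \<subseteq> V" for c L
    using that
  proof (induction "card (V - set L)" arbitrary: c L rule: less_induct)
    case less
    show ?case
    proof (cases "set L = V")
      case True
      then show ?thesis using less by blast
    next
      case False
      then have sub: "set L \<subset> V" using less by blast
      obtain s t where st: "s \<in> set L" "t \<in> set L" "s \<noteq> t"
      proof -
        have "distinct L" "2 \<le> length L" using less.prems(1) by (auto simp: good_order_def)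
        then obtain s t L' where "L = s # t # L'" "s \<noteq> t"
          by (cases L; cases "tl L") auto
        then show thesis using that by auto
      qed
      obtain a X b where X: "a \<in> set L" "b \<in> set L" "a \<noteq> b" "X \<noteq> []" "distinct X"
        "set X \<inter> set L = {}" "set X \<subseteq> V" "successively E (a # X @ [b])"
        by (rule ear_exists[OF _ _ _ sub st]) (assumption | rule conn conn1 E)+
      have "\<exists>c' L'. good_order E c' L' \<and> set L' = set L \<union> set X"
      proof -
        \<comment> \<open>An ear has no direction, so it may be read from whichever end comes first in \<open>L\<close>.\<close>
        have "successively E (rev (a # X @ [b]))"
          using sym X(8) by (rule successively_rev_symp)
        then have X': "successively E (b # rev X @ [a])" by simp
        obtain A B where L: "L = A @ a # B" using X(1) by (meson split_list)
        consider "b \<in> set B" | "b \<in> set A" using X L by auto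
        then show ?thesis
        proof cases
          case 1
          then obtain B1 B2 where "B = B1 @ b # B2" by (meson split_list)
          with L have L': "L = A @ a # B1 @ b # B2" by simp
          from good_order_add_ear[OF less.prems(1) sym this X(4,5,6,8)]
          obtain c' where "good_order E c' (A @ a # X @ B1 @ b # B2)" by blast
          then show ?thesis using L' by (intro exI conjI) auto
        next
          case 2
          then obtain A1 A2 where "A = A1 @ b # A2" by (meson split_list)
          with L have L': "L = A1 @ b # A2 @ a # B" by simp
          have "rev X \<noteq> []" "distinct (rev X)" "set (rev X) \<inter> set L = {}" using X by auto
          from good_order_add_ear[OF less.prems(1) sym L' this X']
          obtain c' where "good_order E c' (A1 @ b # rev X @ A2 @ a # B)" by blast
          then show ?thesis using L' by (intro exI conjI) auto
        qed
      qed
      then obtain c' L' where g': "good_order E c' L'" "set L' = set L \<union> set X" by blast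
      have "V - set L' \<subset> V - set L" using g' X sub by (cases X) auto
      then have "card (V - set L') < card (V - set L)"
        using fin by (intro psubset_card_mono) auto
      moreover have "set L' \<subseteq> V" using g' X less by auto
      ultimately show ?thesis using less.hyps g' by blast
    qed
  qed
  have "E\<^sup>*\<^sup>* u v" using conn uv by blast
  then obtain t where "E u t" using uv by (meson converse_rtranclpE)
  moreover from this have "t \<noteq> u" using irr by blast
  ultimately show ?thesis
    using grow[OF good_order_edge[of E u t]] E[of u t] by auto
qed

text \<open>
  For \<open>u\<close> before \<open>w\<close> the path descends from \<open>u\<close> to the head of \<open>L\<close>, crosses to the last vertex
  and follows the ascending path of \<open>w\<close> backwards. The two parts are disjoint, as one stays at or
  before \<open>u\<close> and the other at or after \<open>w\<close>.
\<close>

lemma good_order_path: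
  assumes good: "good_order E c L" and sym: "symp E" and uv: "u \<in> set L" "v \<in> set L" "u \<noteq> v"
  shows "\<exists>P. hd P = u \<and> last P = v \<and> P \<noteq> [] \<and> distinct P \<and> successively E P \<and>
    locally_rainbow (colour_word c P)"
proof -
  note g = good[unfolded good_order_def]
  have ordered: "\<exists>P. hd P = u \<and> last P = w \<and> P \<noteq> [] \<and> distinct P \<and> successively E P \<and>
    locally_rainbow (colour_word c P)" if L: "L = A @ u # B @ w # D" for u w A B D
  proof -
    have revL: "rev L = rev D @ w # rev B @ u # rev A" using L by simp
    obtain Q where Q: "distinct (u # Q)" "set Q \<subseteq> set A" "last (u # Q) = hd L"
      "successively E (u # Q)" "locally_rainbow (colour_word c (u # Q) @ [0])"
      "Q \<noteq> [] \<Longrightarrow> last (colour_word c (u # Q)) \<in> {1}"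
    by (rule descendsE[OF _ L]) (use g in auto)
    obtain R where R: "distinct (w # R)" "set R \<subseteq> set (rev D)" "last (w # R) = hd (rev L)"
      "successively E (w # R)" "locally_rainbow (colour_word c (w # R) @ [0])"
      "R \<noteq> [] \<Longrightarrow> last (colour_word c (w # R)) \<in> - {1}"
    by (rule descendsE[OF _ revL]) (use g in auto)
    let ?P = "(u # Q) @ rev (w # R)"
    have hdR: "hd (rev (w # R)) = last L"
      using R(3) by (metis hd_rev)
    have word: "colour_word c ?P =
        colour_word c (u # Q) @ 0 # rev (colour_word c (w # R))"
      using colour_word_append[of "u # Q" "rev (w # R)" c] Q(3) hdR g
      by (simp add: colour_word_rev[of c "w # R", simplified])
    have "locally_rainbow (colour_word c ?P)"
      unfolding word
    proof (rule locally_rainbow_join)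
      show "locally_rainbow (0 # rev (colour_word c (w # R)))"
        using R(5) locally_rainbow_rev[of "colour_word c (w # R) @ [0]"] by simp
      assume "colour_word c (u # Q) \<noteq> []" "rev (colour_word c (w # R)) \<noteq> []"
      moreover from this have "Q \<noteq> []" "R \<noteq> []" by auto
      ultimately show "last (colour_word c (u # Q)) \<noteq> hd (rev (colour_word c (w # R)))"
        using Q(6) R(6) by (auto simp: hd_rev)
    qed (rule Q)
    moreover have "successively E ?P"
      using Q(3,4) successively_rev_symp[OF sym R(4)] hdR g unfolding successively_append_iff by auto
    moreover have "distinct ?P" using Q R g L by auto
    ultimately show ?thesis by (intro exI[of _ ?P]) auto
  qed
  obtain A B where L: "L = A @ u # B" using uv by (meson split_list)
  consider "v \<in> set B" | "v \<in> set A" using uv L by auto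
  then show ?thesis
  proof cases
    case 1
    then obtain B1 B2 where "B = B1 @ v # B2" by (meson split_list)
    then show ?thesis using ordered[of A u B1 v B2] L by simp
  next
    case 2
    then obtain A1 A2 where "A = A1 @ v # A2" by (meson split_list)
    then obtain P where "hd P = v" "last P = u" "P \<noteq> []" "distinct P" "successively E P"
      "locally_rainbow (colour_word c P)"
      using ordered[of A1 v A2 u B] L by auto
    then show ?thesis using successively_rev_symp[OF sym]
      by (intro exI[of _ "rev P"]) (auto simp: hd_rev last_rev colour_word_rev)
  qed
qed

section \<open>Transfer to arc walks\<close>

lemma strongly_proper_path_of_vertex_list:
  assumes "pair_graph G" "P \<noteq> []" "distinct P" "hd P \<in> pverts G"
    and "successively (\<lambda>x y. (x, y) \<in> parcs G) P" "locally_rainbow (colour_word c P)"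
  shows "\<exists>p. strongly_proper_path G c (hd P) p (last P)"
proof -
  interpret pair_graph G by fact
  let ?p = "\<lambda>P. zip P (tl P)"
  have conv: "awalk (hd P) (?p P) (last P) \<and> pawalk_verts (hd P) (?p P) = P \<and>
      map (\<lambda>e. c (edge_of e)) (?p P) = colour_word c P"
    if "P \<noteq> []" "hd P \<in> pverts G" "successively (\<lambda>x y. (x, y) \<in> parcs G) P" for P
    using that
  proof (induction P rule: induct_list012)
    case (3 x y zs)
    then have "(x, y) \<in> parcs G" "y \<in> pverts G" by (auto dest: in_arcsD2)
    with 3 show ?case by (auto simp: awalk_Cons_iff edge_of_def)
  qed (auto simp: awalk_Nil_iff)
  note w = conv[OF assms(2,4,5)]
  have len: "length (?p P) = length (colour_word c P)" by simp
  have nth: "c (edge_of (?p P ! i)) = colour_word c P ! i" if "i < length (?p P)" for i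
    using w that by (metis nth_map)
  have "strongly_proper_path G c (hd P) (?p P) (last P)"
    unfolding strongly_proper_path_def
  proof (intro conjI allI impI)
    show "apath (hd P) (?p P) (last P)" using w assms(3) by (simp add: apath_def)
    fix i j assume "i < j \<and> j \<le> i + 2 \<and> j < length (?p P)"
    then show "c (edge_of (?p P ! i)) \<noteq> c (edge_of (?p P ! j))"
      using assms(6) nth[of i] nth[of j] len unfolding locally_rainbow_iff_nth by auto
  qed
  then show ?thesis by blast
qed

lemma reachable_imp_rtranclp:
  assumes "pair_graph G" "u \<rightarrow>\<^sup>*\<^bsub>with_proj G \<restriction> W\<^esub> v"
  shows "(\<lambda>x y. (x, y) \<in> parcs G \<and> y \<in> W)\<^sup>*\<^sup>* u v"
  using assms(2) unfolding reachable_def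
proof (induction rule: rtrancl_on_induct)
  case (step x y)
  then have "(x, y) \<in> parcs G" "y \<in> W"
    by (auto simp: arcs_ends_def arc_to_ends_def induce_subgraph_def)
  then show ?case using step by (auto intro: rtranclp.rtrancl_into_rtrancl)
qed auto

theorem theorem1:
  fixes G :: "'a pair_pre_digraph"
  assumes "pair_graph G"
    and "Digraph_Component.connected (with_proj G)"
    and "k_connected 2 G"
  shows "spc G \<le> 5"
proof -
  interpret pair_graph G by fact
  let ?E = "\<lambda>x y. (x, y) \<in> parcs G"
  let ?V = "pverts G"
  have sym: "symp ?E" using arcs_symmetric by (auto intro: sympI)
  have conn: "(\<lambda>x y. ?E x y \<and> y \<in> ?V - S)\<^sup>*\<^sup>* u v"
    if S: "S \<subset> ?V" "card S < 2" "u \<in> ?V - S" "v \<in> ?V - S" for S u v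
  proof -
    have "Digraph_Component.connected (with_proj G \<restriction> (?V - S))"
      using assms(3) S by (auto simp: k_connected_def)
    moreover have "symmetric (with_proj G \<restriction> (?V - S))"
      using arcs_symmetric
      by (auto simp: symmetric_def induce_subgraph_def arcs_ends_def arc_to_ends_def intro!: symI)
    ultimately have "strongly_connected (with_proj G \<restriction> (?V - S))"
      by (intro wf_digraph.symmetric_connected_imp_strongly_connected
          wellformed_induce_subgraph)
    then have "u \<rightarrow>\<^sup>*\<^bsub>with_proj G \<restriction> (?V - S)\<^esub> v"
      using S by (auto simp: strongly_connected_def)
    then show ?thesis by (rule reachable_imp_rtranclp[OF assms(1)])
  qed
  \<comment> \<open>A single vertex is a possible graph here; it has no edge \<open>st\<close> to start from.\<close>
  have "\<exists>c :: 'a set \<Rightarrow> nat. range c \<subseteq> {..<5} \<and> strongly_proper_connected G c"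
  proof (cases "\<exists>u \<in> ?V. \<exists>v \<in> ?V. u \<noteq> v")
    case False
    then have "strongly_proper_connected G (\<lambda>_. 0 :: nat)"
      by (auto simp: strongly_proper_connected_def)
    then show ?thesis by (intro exI[of _ "\<lambda>_. 0"]) auto
  next
    case True
    then obtain u v where uv: "u \<in> ?V" "v \<in> ?V" "u \<noteq> v" by blast
    have "\<exists>c L. good_order ?E c L \<and> set L = ?V"
    proof (rule good_order_exists[OF _ sym _ _ _ _ uv])
      fix x y assume xy: "x \<in> ?V" "y \<in> ?V"
      have "(\<lambda>x y. ?E x y \<and> y \<in> ?V - {})\<^sup>*\<^sup>* x y"
        by (rule conn) (use xy in auto)
      then show "?E\<^sup>*\<^sup>* x y" by (rule rtranclp_mono[THEN predicate2D, rotated]) auto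
    next
      fix a x y assume "a \<in> ?V" "x \<in> ?V - {a}" "y \<in> ?V - {a}"
      then show "(\<lambda>x y. ?E x y \<and> y \<in> ?V - {a})\<^sup>*\<^sup>* x y"
        by (intro conn) auto
    qed (auto dest: no_loops' in_arcsD1 in_arcsD2)
    then obtain c L where cL: "good_order ?E c L" "set L = ?V" by blast
    have "strongly_proper_connected G c"
      unfolding strongly_proper_connected_def
    proof (intro ballI impI)
      fix x y assume xy: "x \<in> ?V" "y \<in> ?V" "x \<noteq> y"
      then obtain P where "hd P = x" "last P = y" "P \<noteq> []" "distinct P" "successively ?E P"
        "locally_rainbow (colour_word c P)"
        using good_order_path[OF cL(1) sym, of x y] cL(2) by auto
      then show "\<exists>p. strongly_proper_path G c x p y"
        using strongly_proper_path_of_vertex_list[OF assms(1), of P c] xy by auto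
    qed
    then show ?thesis using cL(1) by (auto simp: good_order_def)
  qed
  then obtain c :: "'a set \<Rightarrow> nat"
    where c: "range c \<subseteq> {..<5}" "strongly_proper_connected G c" by blast
  have "spc G \<le> card (c ` edges G)"
    unfolding spc_def using c(2) by (intro Least_le) blast
  also have "\<dots> \<le> card {..<5::nat}" using c(1) by (intro card_mono) auto
  finally show ?thesis by simp
qed

end
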